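(* Let $N$ be a finite set, $Q\subseteq\mathbb{R}^N$ a polyhedron, $Z\subseteq Q$, and $R\subseteq\mathbb{R}^N$ a convex set containing the origin, and let $c\in\mathbb{R}^N$. Suppose we are given a $(Q,Z)$-face-preserving rounding algorithm with error body $R$. Given $x\in Q$, let $y^*$ be an optimal solution of $\min\{c^Ty: y\in Q\cap(x-R)\}$ (assumed to be attained), and let $z\in Z$ be the output of the $(Q,Z)$-FPRA applied to $y^*$. Then $c^Tz\le c^Tx$ and $z\in x+(R-R)$.
   Context: For sets, $x-R=\{x-r:r\in R\}$ and $x+(R-R)=\{x+r_1-r_2:r_1,r_2\in R\}$ (Minkowski sums). A $(Q,Z)$-face-preserving rounding algorithm (FPRA) with error body $R$, where $Q\subseteq\mathbb{R}^N$ is a polyhedron, $Z\subseteq Q$, and $R\subseteq\mathbb{R}^N$ is a convex set containing the origin, is an algorithm that takes as input a point $x\in Q$ and returns a point $z\in Z$ with $z-x\in R$ such that $z$ lies on the minimal face of $Q$ containing $x$. *)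

theory Defs
  imports "HOL-Analysis.Analysis"
begin

definition minimal_face :: "(real ^ 'n) set \<Rightarrow> real ^ 'n \<Rightarrow> (real ^ 'n) set" where
  "minimal_face Q x = \<Inter> {F. F face_of Q \<and> x \<in> F}"

lemma mem_minimal_face: "x \<in> minimal_face Q x"
  by (simp add: minimal_face_def)

lemma minimal_face_face_of:
  assumes "polyhedron Q" "x \<in> Q"
  shows "minimal_face Q x face_of Q"
proof -
  have "Q \<in> {F. F face_of Q \<and> x \<in> F}"
    using assms by (simp add: face_of_refl polyhedron_imp_convex)
  then have "{F. F face_of Q \<and> x \<in> F} \<noteq> {}"
    by blast
  then show ?thesis
    unfolding minimal_face_def by (rule face_of_Inter) simp
qed

lemma minimal_face_subset: "F face_of Q \<Longrightarrow> x \<in> F \<Longrightarrow> minimal_face Q x \<subseteq> F"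
  by (auto simp: minimal_face_def)

text \<open>
  The rounding algorithm is represented by its input-output map \<open>A\<close>. Only inputs in \<open>Q\<close> are
  constrained; values of \<open>A\<close> elsewhere are irrelevant.
\<close>

definition face_preserving_rounding ::
  "(real ^ 'n) set \<Rightarrow> (real ^ 'n) set \<Rightarrow> (real ^ 'n) set \<Rightarrow> (real ^ 'n \<Rightarrow> real ^ 'n) \<Rightarrow> bool" where
  "face_preserving_rounding Q Z R A \<longleftrightarrow>
     (\<forall>x\<in>Q. A x \<in> Z \<and> A x - x \<in> R \<and> A x \<in> minimal_face Q x)"

end

theory Submission
  imports Defs
begin

text \<open>
  Write \<open>y\<close> for the optimal solution. It lies in the relative interior of its minimal face, so the
  segment from \<open>z\<close> to \<open>y\<close> can be prolonged beyond \<open>y\<close> inside \<open>Q\<close>; averaging the prolonged point with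
  \<open>x\<close> gives \<open>y + e (x - z) \<in> Q\<close> for some \<open>0 < e < 1\<close>. Since \<open>x - (y + e (x - z))\<close> is the convex
  combination \<open>(1 - e) (x - y) + e (z - y)\<close> of points of \<open>R\<close>, the moved point is feasible, and
  optimality of \<open>y\<close> yields \<open>c \<bullet> (x - z) \<ge> 0\<close>.
\<close>

lemma convex_minimal_face_face_of:
  fixes Q :: "(real ^ 'n) set"
  assumes "convex Q" "y \<in> Q"
  shows "minimal_face Q y face_of Q"
  unfolding minimal_face_def
  using assms by (intro face_of_Inter) (auto intro: face_of_refl)

text \<open>Otherwise some hyperplane supports the minimal face at \<open>y\<close> and misses its
  relative interior. It cuts out a face of \<open>Q\<close> through \<open>y\<close>, which by
  minimality is the whole minimal face; but the relative interior of a nonempty convex set is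
  nonempty, a contradiction.\<close>

lemma mem_rel_interior_minimal_face:
  fixes Q :: "(real ^ 'n) set"
  assumes "convex Q" "y \<in> Q"
  shows "y \<in> rel_interior (minimal_face Q y)"
proof (rule ccontr)
  let ?F = "minimal_face Q y"
  assume not_int: "y \<notin> rel_interior ?F"
  have F: "?F face_of Q"
    using assms by (rule convex_minimal_face_face_of)
  then have conv: "convex ?F"
    by (rule face_of_imp_convex)
  obtain a where le: "\<And>w. w \<in> ?F \<Longrightarrow> a \<bullet> y \<le> a \<bullet> w"
    and less: "\<And>w. w \<in> rel_interior ?F \<Longrightarrow> a \<bullet> y < a \<bullet> w"
    using supporting_hyperplane_rel_boundary[OF conv mem_minimal_face not_int] by metis
  have "?F \<inter> {w. a \<bullet> w = a \<bullet> y} face_of ?F"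
    using conv le by (rule face_of_Int_supporting_hyperplane_ge)
  then have "?F \<inter> {w. a \<bullet> w = a \<bullet> y} face_of Q"
    using F by (rule face_of_trans)
  then have "?F \<subseteq> {w. a \<bullet> w = a \<bullet> y}"
    using minimal_face_subset mem_minimal_face by blast
  moreover obtain w where "w \<in> rel_interior ?F"
    using conv mem_minimal_face rel_interior_eq_empty by blast
  ultimately show False
    using less rel_interior_subset by fastforce
qed

lemma minimal_face_extend:
  fixes Q :: "(real ^ 'n) set"
  assumes "convex Q" "y \<in> Q" "z \<in> minimal_face Q y"
  obtains d where "d > 0" "y - d *\<^sub>R (z - y) \<in> Q"
proof -
  have F: "minimal_face Q y face_of Q"
    using assms by (intro convex_minimal_face_face_of)
  \<comment> \<open>This point equals \<open>y + (e - 1) (y - z)\<close>, so the overshoot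
    \<open>e - 1\<close> serves as \<open>d\<close>.\<close>
  obtain e where e: "e > 1" "(1 - e) *\<^sub>R z + e *\<^sub>R y \<in> minimal_face Q y"
    using convex_rel_interior_if2[OF face_of_imp_convex[OF F]
        mem_rel_interior_minimal_face[OF assms(1,2)]] hull_inc[OF assms(3)]
    by blast
  show thesis
  proof
    show "e - 1 > 0" using e by simp
    have "y - (e - 1) *\<^sub>R (z - y) = (1 - e) *\<^sub>R z + e *\<^sub>R y"
      by (simp add: algebra_simps)
    then show "y - (e - 1) *\<^sub>R (z - y) \<in> Q"
      using e face_of_imp_subset[OF F] by auto
  qed
qed

theorem theorem2p2:
  fixes Q Z R :: "(real ^ 'n) set"
    and A :: "real ^ 'n \<Rightarrow> real ^ 'n"
    and c x y_opt z :: "real ^ 'n"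
  assumes "polyhedron Q"
    and "Z \<subseteq> Q"
    and "convex R"
    and "0 \<in> R"
    and "face_preserving_rounding Q Z R A"
    and "x \<in> Q"
    and "is_arg_min (\<lambda>y. c \<bullet> y) (\<lambda>y. y \<in> Q \<inter> {x - r | r. r \<in> R}) y_opt"
    and "z = A y_opt"
  shows "c \<bullet> z \<le> c \<bullet> x \<and> z \<in> {x + r1 - r2 | r1 r2. r1 \<in> R \<and> r2 \<in> R}"
proof -
  let ?y = y_opt
  have y: "?y \<in> Q" and xy: "x - ?y \<in> R"
    and opt: "\<And>w. w \<in> Q \<Longrightarrow> x - w \<in> R \<Longrightarrow> c \<bullet> ?y \<le> c \<bullet> w"
    using assms(7) by (force simp: is_arg_min_linorder)+
  have zy: "z - ?y \<in> R" and zF: "z \<in> minimal_face Q ?y"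
    using assms(5,8) y by (auto simp: face_preserving_rounding_def)
  have Q: "convex Q"
    using assms(1) by (rule polyhedron_imp_convex)
  obtain d where d: "d > 0" "?y - d *\<^sub>R (z - ?y) \<in> Q"
    using minimal_face_extend[OF Q y zF] .
  \<comment> \<open>Chosen so that \<open>(1 - e) d = e\<close>: in the average of the prolonged
    point and \<open>x\<close> with weights \<open>1 - e\<close> and \<open>e\<close>, the total
    coefficient of \<open>y\<close> is then 1 and that of \<open>z\<close> is
    \<open>- e\<close>.\<close>
  define e where "e = d / (1 + d)"
  have e: "0 < e" "e < 1" and ed: "(1 - e) * d = e"
    using d(1) by (auto simp: e_def field_simps)
  let ?w = "?y + e *\<^sub>R (x - z)"
  have "?w = (1 - e) *\<^sub>R ?y - ((1 - e) * d) *\<^sub>R (z - ?y) + e *\<^sub>R x"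
    unfolding ed by (simp add: algebra_simps)
  also have "\<dots> = (1 - e) *\<^sub>R (?y - d *\<^sub>R (z - ?y)) + e *\<^sub>R x"
    by (simp add: scaleR_right_diff_distrib)
  also have "\<dots> \<in> Q"
    using e by (intro convexD_alt Q d assms(6)) auto
  finally have wQ: "?w \<in> Q" .
  have "x - ?w = (1 - e) *\<^sub>R (x - ?y) + e *\<^sub>R (z - ?y)"
    by (simp add: algebra_simps)
  also have "\<dots> \<in> R"
    using e by (intro convexD_alt assms(3) xy zy) auto
  finally have "c \<bullet> ?y \<le> c \<bullet> ?w"
    using wQ opt by blast
  then have "0 \<le> e * (c \<bullet> x - c \<bullet> z)"
    by (simp add: inner_add_right inner_diff_right)
  then have "c \<bullet> z \<le> c \<bullet> x"
    using e by (simp add: zero_le_mult_iff)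
  \<comment> \<open>The witnesses for \<open>R - R\<close> are the rounding error
    \<open>z - y\<close> and the displacement \<open>x - y\<close>.\<close>
  moreover have "z = x + (z - ?y) - (x - ?y)"
    by simp
  ultimately show ?thesis
    using zy xy by blast
qed

end
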